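(* For every odd integer $m>1$, the class number of the quadratic field $\mathbb{Q}\left(\sqrt{1-2m^3}\right)$ is divisible by $3$. *)

theory Defs
  imports
    Complex_Main
    "HOL-Algebra.Coset"
    "HOL-Algebra.Generated_Fields"
    "HOL-Algebra.Ideal_Product"
    "HOL-Algebra.Algebraic_Closure_Type"
begin

text \<open>
  Number fields are represented as subsets of the complex numbers.  The library's
  \<^const>\<open>ring_of_type_algebra\<close> supplies the complex field as an algebraic structure.
\<close>

abbreviation complex_field :: "complex ring" where
  "complex_field \<equiv> ring_of_type_algebra"

definition quadratic_field :: "int \<Rightarrow> complex set" where
  "quadratic_field D = generate_field complex_field (\<rat> \<union> {csqrt (of_int D)})"

definition ring_of_integers :: "complex set \<Rightarrow> complex set" where
  "ring_of_integers K = {x \<in> K. algebraic_int x}"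

definition fractional_ideal :: "complex set \<Rightarrow> complex set \<Rightarrow> bool" where
  "fractional_ideal K I \<longleftrightarrow>
     I \<subseteq> K \<and> I \<noteq> {0} \<and>
     additive_subgroup I complex_field \<and>
     (\<forall>r\<in>ring_of_integers K. \<forall>x\<in>I. r * x \<in> I) \<and>
     (\<exists>d\<in>ring_of_integers K. d \<noteq> 0 \<and> (\<forall>x\<in>I. d * x \<in> ring_of_integers K))"

definition ideal_group :: "complex set \<Rightarrow> complex set monoid" where
  "ideal_group K =
     \<lparr>carrier = {I. fractional_ideal K I},
      monoid.mult = ideal_prod complex_field,
      one = ring_of_integers K\<rparr>"

definition principal_fractional_ideals :: "complex set \<Rightarrow> complex set set" where
  "principal_fractional_ideals K =
     {(\<lambda>r. a * r) ` ring_of_integers K | a. a \<in> K \<and> a \<noteq> 0}"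

definition class_group :: "complex set \<Rightarrow> complex set set monoid" where
  "class_group K = ideal_group K Mod principal_fractional_ideals K"

definition class_number :: "complex set \<Rightarrow> nat" where
  "class_number K = Coset.order (class_group K)"

end

theory Submission
  imports Defs
begin

text \<open>
  Put \<open>D = 1 - 2 m\<^sup>3\<close>, which is negative and congruent to 3 modulo 4, and
  \<open>\<beta> = 1 - m\<^sup>3 + \<surd>D\<close>, which has norm \<open>m\<^sup>6\<close> and is comaximal with its conjugate.
  Hence \<open>J = (m\<^sup>2, \<beta>)\<close> satisfies \<open>J\<^sup>3 = (\<beta>)\<close>, and the map \<open>T\<close> sending \<open>I\<close> to
  \<open>J I = m\<^sup>2 I + \<beta> I\<close> induces a permutation of the set of ideal classes whose cube is the identity.
  It has no fixed point, since otherwise \<open>\<beta>\<close> would be a cube, which is impossible for \<open>m > 1\<close>;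
  so all its orbits have three elements.  Working with this action instead of an element of order
  three avoids proving that the fractional ideals form a group, and if there were infinitely many
  classes their cardinality would be 0 by convention.

  Integrality is obtained from norms: if \<open>x I \<subseteq> I\<close>, then all powers of \<open>x\<close> have a common
  denominator, which forces the rational number \<open>|x|\<^sup>2\<close> to be an integer; the same
  for \<open>x + 1\<close> shows that the trace of \<open>x\<close> is an integer.
\<close>

section \<open>Orbit counting and a denominator argument for rational numbers\<close>

lemma three_dvd_card_free_cyclic_map:
  assumes maps: "\<And>x. x \<in> S \<Longrightarrow> f x \<in> S"
    and cube: "\<And>x. x \<in> S \<Longrightarrow> f (f (f x)) = x"
    and free: "\<And>x. x \<in> S \<Longrightarrow> f x \<noteq> x"
  shows "3 dvd card S"
proof (cases "finite S")
  case True
  define r where "r = {(x, y). x \<in> S \<and> (y = x \<or> y = f x \<or> y = f (f x))}"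
  have "equiv S r"
  proof (rule equivI)
    show "r \<subseteq> S \<times> S" using maps by (auto simp: r_def)
    show "refl_on S r" by (auto simp: r_def refl_on_def)
    show "sym r" using maps cube by (auto simp: r_def sym_def)
    show "trans r" using maps cube by (auto simp: r_def trans_def)
  qed
  moreover have "3 dvd card C" if "C \<in> S // r" for C
  proof -
    from that obtain x where x: "x \<in> S" "C = r `` {x}" by (auto simp: quotient_def)
    have C: "C = {x, f x, f (f x)}" using x by (auto simp: r_def)
    \<comment> \<open>Applying \<open>f\<close> to \<open>f (f x) = x\<close> would give
      \<open>x = f x\<close>.\<close>
    have "f (f x) \<noteq> x"
      using cube[OF x(1)] free[OF x(1)] by metis
    then have "card C = 3"
      using free[OF x(1)] free[OF maps[OF x(1)]] by (simp add: C card_insert_if)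
    then show ?thesis by simp
  qed
  ultimately show ?thesis by (rule equiv_imp_dvd_card[OF True])
qed simp

text \<open>The case \<open>n = 0\<close> makes \<open>E\<close> an integer. In lowest terms
  \<open>r = a / b\<close>, every \<open>b ^ n\<close> divides \<open>E\<close>, which forces
  \<open>b = 1\<close>.\<close>

lemma rational_bounded_denominator_powers_int:
  fixes r E :: real
  assumes "r \<in> \<rat>" "E \<noteq> 0" and E: "\<And>n. E * r ^ n \<in> \<int>"
  shows "r \<in> \<int>"
proof -
  obtain a b where ab: "b > 0" "coprime a b" "r = of_int a / of_int b"
    using \<open>r \<in> \<rat>\<close> by (elim Rats_cases') auto
  obtain k :: int where k: "E = of_int k" using E[of 0] by (auto elim: Ints_cases)
  have dvd: "b ^ n dvd k" for n
  proof -
    obtain j :: int where "E * r ^ n = of_int j" using E[of n] by (auto elim: Ints_cases)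
    then have "real_of_int (k * a ^ n) = of_int (j * b ^ n)"
      using ab by (simp add: k power_divide field_simps)
    then have "k * a ^ n = j * b ^ n" by (simp only: of_int_eq_iff)
    then have "b ^ n dvd k * a ^ n" by simp
    moreover have "coprime (b ^ n) (a ^ n)" using ab(2) by (simp add: coprime_commute)
    ultimately show ?thesis by (simp add: coprime_dvd_mult_left_iff)
  qed
  have "b = 1"
  proof (rule ccontr)
    assume "b \<noteq> 1"
    then have b2: "2 \<le> b" using ab(1) by simp
    have "k \<noteq> 0" using k \<open>E \<noteq> 0\<close> by simp
    \<comment> \<open>This exponent is large enough: \<open>b ^ n\<close> is at least
      \<open>2 ^ n > n = |k|\<close>, too big for a divisor of \<open>k\<close>.\<close>
    define n where "n = nat \<bar>k\<bar>"
    have "int n < 2 ^ n" by (metis of_nat_less_two_power)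
    also have "2 ^ n \<le> b ^ n" using b2 by (intro power_mono) auto
    also have "b ^ n \<le> \<bar>k\<bar>" using dvd_imp_le_int[OF \<open>k \<noteq> 0\<close> dvd[of n]] ab(1) by simp
    finally show False by (simp add: n_def)
  qed
  then show ?thesis using ab by simp
qed

section \<open>Field operations and additive subgroups in ordinary complex notation\<close>

lemma complex_field_simps:
  "carrier complex_field = UNIV"
  "x \<otimes>\<^bsub>complex_field\<^esub> y = x * y"
  "x \<oplus>\<^bsub>complex_field\<^esub> y = x + y"
  "\<one>\<^bsub>complex_field\<^esub> = 1"
  "\<zero>\<^bsub>complex_field\<^esub> = 0"
  by (simp_all add: ring_of_type_algebra_def)

lemma complex_field_a_inv: "\<ominus>\<^bsub>complex_field\<^esub> x = - x"
proof -
  interpret field complex_field by rule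
  have "(- x) \<oplus>\<^bsub>complex_field\<^esub> x = \<zero>\<^bsub>complex_field\<^esub>" by (simp add: complex_field_simps)
  then show ?thesis
    by (rule minus_equality) (simp_all add: complex_field_simps)
qed

lemma complex_field_m_inv:
  assumes "x \<noteq> 0"
  shows "inv\<^bsub>complex_field\<^esub> x = inverse x"
proof -
  interpret field complex_field by rule
  show ?thesis
    using assms by (intro comm_inv_char) (simp_all add: complex_field_simps)
qed

lemma subgroup_add_complex_field_iff:
  "additive_subgroup I complex_field \<longleftrightarrow>
     0 \<in> I \<and> (\<forall>x\<in>I. \<forall>y\<in>I. x + y \<in> I) \<and> (\<forall>x\<in>I. - x \<in> I)"
proof
  assume "additive_subgroup I complex_field"
  then interpret additive_subgroup I complex_field .
  show "0 \<in> I \<and> (\<forall>x\<in>I. \<forall>y\<in>I. x + y \<in> I) \<and> (\<forall>x\<in>I. - x \<in> I)"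
    using zero_closed a_closed a_inv_closed
    by (simp add: complex_field_simps complex_field_a_inv)
next
  assume *: "0 \<in> I \<and> (\<forall>x\<in>I. \<forall>y\<in>I. x + y \<in> I) \<and> (\<forall>x\<in>I. - x \<in> I)"
  show "additive_subgroup I complex_field"
  proof (intro additive_subgroupI subgroup.intro)
    show "inv\<^bsub>add_monoid complex_field\<^esub> x \<in> I" if "x \<in> I" for x
      using * that complex_field_a_inv[of x, unfolded a_inv_def] by metis
  qed (use * in \<open>auto simp: complex_field_simps\<close>)
qed

section \<open>Closure properties, coordinates and norms in the quadratic field\<close>

lemma quadratic_field_mult:
  "x \<in> quadratic_field D \<Longrightarrow> y \<in> quadratic_field D \<Longrightarrow> x * y \<in> quadratic_field D"
  unfolding quadratic_field_def
  using generate_field.eng_mult[of x complex_field] by (simp add: complex_field_simps)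

lemma quadratic_field_add:
  "x \<in> quadratic_field D \<Longrightarrow> y \<in> quadratic_field D \<Longrightarrow> x + y \<in> quadratic_field D"
  unfolding quadratic_field_def
  using generate_field.eng_add[of x complex_field] by (simp add: complex_field_simps)

lemma quadratic_field_uminus:
  "x \<in> quadratic_field D \<Longrightarrow> - x \<in> quadratic_field D"
  unfolding quadratic_field_def
  using generate_field.a_inv[of x complex_field] by (simp add: complex_field_a_inv)

lemma quadratic_field_rat: "x \<in> \<rat> \<Longrightarrow> x \<in> quadratic_field D"
  unfolding quadratic_field_def by (intro generate_field.incl) auto

lemma quadratic_field_csqrt: "csqrt (of_int D) \<in> quadratic_field D"
  unfolding quadratic_field_def by (intro generate_field.incl) auto

lemma quadratic_field_inverse:
  "x \<in> quadratic_field D \<Longrightarrow> inverse x \<in> quadratic_field D"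
  \<comment> \<open>At \<open>x = 0\<close> the convention \<open>inverse 0 = 0\<close> leaves only
    membership of 0 to check.\<close>
  using generate_field.m_inv[of x complex_field] quadratic_field_rat[of 0 D]
  unfolding quadratic_field_def
  by (cases "x = 0") (simp_all add: complex_field_simps complex_field_m_inv)

lemma quadratic_field_divide:
  "x \<in> quadratic_field D \<Longrightarrow> y \<in> quadratic_field D \<Longrightarrow> x / y \<in> quadratic_field D"
  by (simp add: divide_inverse quadratic_field_mult quadratic_field_inverse)

text \<open>Multiply by the conjugate \<open>p - q * w\<close>. If the conjugate is 0, then either
  \<open>q = 0\<close> or \<open>w\<close> is itself rational, and the inverse is rational.\<close>

lemma Rats_sums_csqrt_inverse:
  fixes w :: complex
  assumes "w ^ 2 \<in> \<rat>" "p \<in> \<rat>" "q \<in> \<rat>"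
  shows "\<exists>p'\<in>\<rat>. \<exists>q'\<in>\<rat>. inverse (p + q * w) = p' + q' * w"
proof (cases "p - q * w = 0")
  case True
  show ?thesis
  proof (cases "q = 0")
    case True
    then show ?thesis using assms by (intro bexI[of _ "inverse p"] bexI[of _ 0]) auto
  next
    case False
    then have "w = p / q" using \<open>p - q * w = 0\<close> by (simp add: field_simps)
    then have "w \<in> \<rat>" using assms by simp
    then show ?thesis using assms
      by (intro bexI[of _ "inverse (p + q * w)"] bexI[of _ 0]) auto
  qed
next
  case False
  define N where "N = p ^ 2 - q ^ 2 * w ^ 2"
  have N: "N \<in> \<rat>" using assms by (auto simp: N_def)
  have fac: "N = (p + q * w) * (p - q * w)" by (simp add: N_def algebra_simps power2_eq_square)
  have "inverse (p + q * w) = p / N + (- q / N) * w"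
  \<comment> \<open>If this is 0, so is \<open>N\<close>, and both sides are 0 by the convention for
    division by zero.\<close>
  proof (cases "p + q * w = 0")
    case nz: False
    have "p / N + (- q / N) * w = (p - q * w) / N" by (simp add: diff_divide_distrib)
    then show ?thesis using False nz by (simp add: fac inverse_eq_divide)
  qed (simp add: fac)
  then show ?thesis using N assms by (intro bexI[of _ "p / N"] bexI[of _ "- q / N"]) auto
qed

lemma csqrt_combination_mult:
  "(p + q * csqrt z) * (p' + q' * csqrt z) = (p * p' + q * q' * z) + (p * q' + q * p') * csqrt z"
proof -
  have "(p + q * w) * (p' + q' * w) = (p * p' + q * q' * w\<^sup>2) + (p * q' + q * p') * w" for w :: complex
    by (simp add: algebra_simps power2_eq_square)
  then show ?thesis by (metis power2_csqrt)
qed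

lemma quadratic_field_cases:
  assumes "x \<in> quadratic_field D"
  shows "\<exists>p\<in>\<rat>. \<exists>q\<in>\<rat>. x = p + q * csqrt (of_int D)"
  using assms unfolding quadratic_field_def
proof (induction rule: generate_field.induct)
  case one
  then show ?case by (intro bexI[of _ 1] bexI[of _ 0]) (auto simp: complex_field_simps)
next
  case (incl h)
  then show ?case
  proof
    assume "h \<in> \<rat>"
    then show ?thesis by (intro bexI[of _ h] bexI[of _ 0]) auto
  next
    assume "h \<in> {csqrt (of_int D)}"
    then show ?thesis by (intro bexI[of _ 0] bexI[of _ 1]) auto
  qed
next
  case (a_inv h)
  then obtain p q where "p \<in> \<rat>" "q \<in> \<rat>" "h = p + q * csqrt (of_int D)" by blast
  then show ?case
    by (intro bexI[of _ "- p"] bexI[of _ "- q"]) (auto simp: complex_field_a_inv)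
next
  case (m_inv h)
  then show ?case
    using Rats_sums_csqrt_inverse[of "csqrt (of_int D)"]
    by (auto simp: complex_field_simps complex_field_m_inv)
next
  case (eng_add h1 h2)
  then obtain p q p' q' where "p \<in> \<rat>" "q \<in> \<rat>" "h1 = p + q * csqrt (of_int D)"
    "p' \<in> \<rat>" "q' \<in> \<rat>" "h2 = p' + q' * csqrt (of_int D)" by blast
  then show ?case
    by (intro bexI[of _ "p + p'"] bexI[of _ "q + q'"]) (auto simp: complex_field_simps algebra_simps)
next
  case (eng_mult h1 h2)
  then obtain p q p' q' where h: "p \<in> \<rat>" "q \<in> \<rat>" "h1 = p + q * csqrt (of_int D)"
    "p' \<in> \<rat>" "q' \<in> \<rat>" "h2 = p' + q' * csqrt (of_int D)" by blast
  have "h1 * h2 = (p * p' + q * q' * of_int D) + (p * q' + q * p') * csqrt (of_int D)"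
    unfolding h by (rule csqrt_combination_mult)
  then show ?case using h
    by (intro bexI[of _ "p * p' + q * q' * of_int D"] bexI[of _ "p * q' + q * p'"])
      (auto simp: complex_field_simps)
qed

lemma csqrt_negative_int:
  assumes "D < 0"
  shows "csqrt (of_int D) = \<i> * of_real (sqrt (- of_int D))"
  using assms csqrt_of_real_nonpos[of "of_int D"] by simp

text \<open>For negative \<open>D\<close> the square root is purely imaginary, so the squared
  modulus is the field norm.\<close>

lemma quadratic_field_norm:
  assumes "D < 0" "x \<in> quadratic_field D"
  shows "\<exists>p\<in>\<rat>. \<exists>q\<in>\<rat>. Re x = p \<and> (cmod x)\<^sup>2 = p\<^sup>2 - q\<^sup>2 * of_int D"
proof -
  obtain p q :: complex where pq: "p \<in> \<rat>" "q \<in> \<rat>" "x = p + q * csqrt (of_int D)"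
    using quadratic_field_cases[OF assms(2)] by blast
  obtain p' q' where p': "p = of_rat p'" and q': "q = of_rat q'"
    using pq by (auto elim!: Rats_cases)
  have rat: "of_rat r = complex_of_real (of_rat r)" for r
    by (cases r) (simp add: of_rat_rat)
  have "Re x = of_rat p'" "Im x = of_rat q' * sqrt (- of_int D)"
    unfolding pq(3) p' q' rat csqrt_negative_int[OF assms(1)] by simp_all
  moreover have "(sqrt (- of_int D))\<^sup>2 = - of_int D" using assms(1) by simp
  ultimately have "Re x = of_rat p'" "(cmod x)\<^sup>2 = (of_rat p')\<^sup>2 - (of_rat q')\<^sup>2 * of_int D"
    by (simp_all add: cmod_power2 power_mult_distrib)
  then show ?thesis by (intro bexI[of _ "of_rat p'"] bexI[of _ "of_rat q'"]) auto
qed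

section \<open>Integrality of norms by clearing denominators\<close>

text \<open>The order Z[sqrt D], where integrality of norms is a direct computation; denominators
  are cleared into it.\<close>

definition quadratic_order :: "int \<Rightarrow> complex set" where
  "quadratic_order D = {of_int a + of_int b * csqrt (of_int D) | a b. True}"

lemma quadratic_order_of_int: "of_int a \<in> quadratic_order D"
  unfolding quadratic_order_def by (intro CollectI exI[of _ a] exI[of _ 0]) simp

lemma quadratic_order_add:
  assumes "x \<in> quadratic_order D" "y \<in> quadratic_order D"
  shows "x + y \<in> quadratic_order D"
proof -
  obtain a b c d where "x = of_int a + of_int b * csqrt (of_int D)"
    "y = of_int c + of_int d * csqrt (of_int D)"
    using assms unfolding quadratic_order_def by blast
  then have "x + y = of_int (a + c) + of_int (b + d) * csqrt (of_int D)"
    by (simp add: algebra_simps)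
  then show ?thesis unfolding quadratic_order_def by blast
qed

lemma quadratic_order_mult:
  assumes "x \<in> quadratic_order D" "y \<in> quadratic_order D"
  shows "x * y \<in> quadratic_order D"
proof -
  obtain a b c d where xy: "x = of_int a + of_int b * csqrt (of_int D)"
    "y = of_int c + of_int d * csqrt (of_int D)"
    using assms unfolding quadratic_order_def by blast
  have "x * y = of_int (a * c + b * d * D) + of_int (a * d + b * c) * csqrt (of_int D)"
    unfolding xy of_int_add of_int_mult by (rule csqrt_combination_mult)
  then show ?thesis unfolding quadratic_order_def by blast
qed

lemma quadratic_order_power: "x \<in> quadratic_order D \<Longrightarrow> x ^ n \<in> quadratic_order D"
  using quadratic_order_of_int[of 1]
  by (induction n) (auto intro: quadratic_order_mult)

lemma quadratic_order_sum:
  "(\<And>i. i \<in> A \<Longrightarrow> f i \<in> quadratic_order D) \<Longrightarrow> sum f A \<in> quadratic_order D"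
  using quadratic_order_of_int[of 0]
  by (induction A rule: infinite_finite_induct) (auto intro: quadratic_order_add)

lemma quadratic_order_norm:
  assumes "D < 0" "x \<in> quadratic_order D"
  shows "(cmod x)\<^sup>2 \<in> \<int>"
proof -
  obtain a b where x: "x = of_int a + of_int b * csqrt (of_int D)"
    using assms unfolding quadratic_order_def by blast
  have "Re x = of_int a" "Im x = of_int b * sqrt (- of_int D)"
    unfolding x csqrt_negative_int[OF assms(1)] by simp_all
  moreover have "(sqrt (- of_int D))\<^sup>2 = - of_int D" using assms(1) by simp
  ultimately have "(cmod x)\<^sup>2 = of_int (a\<^sup>2 - b\<^sup>2 * D)"
    by (simp add: cmod_power2 power_mult_distrib)
  then show ?thesis by (metis Ints_of_int)
qed

lemma quadratic_field_denominator:
  assumes "x \<in> quadratic_field D"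
  shows "\<exists>c::int. c \<noteq> 0 \<and> of_int c * x \<in> quadratic_order D"
proof -
  obtain p q :: complex where pq: "p \<in> \<rat>" "q \<in> \<rat>" "x = p + q * csqrt (of_int D)"
    using quadratic_field_cases[OF assms] by blast
  obtain a b where p: "b > 0" "p = of_int a / of_int b" using pq(1) by (elim Rats_cases') auto
  obtain c d where q: "d > 0" "q = of_int c / of_int d" using pq(2) by (elim Rats_cases') auto
  have "of_int (b * d) * x = of_int (a * d) + of_int (b * c) * csqrt (of_int D)"
    using p(1) q(1) by (simp add: pq(3) p(2) q(2) distrib_left)
  then have "of_int (b * d) * x \<in> quadratic_order D" unfolding quadratic_order_def by blast
  then show ?thesis using p q by (intro exI[of _ "b * d"]) auto
qed

text \<open>A monic equation of degree \<open>k\<close> expresses all powers of \<open>x\<close>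
  through those below \<open>k\<close> with integer coefficients. If \<open>c\<close> clears the
  denominator of \<open>x\<close>, then \<open>c ^ k\<close> clears those of all powers.\<close>

lemma algebraic_int_bounded_denominator_powers:
  assumes "x \<in> quadratic_field D" "algebraic_int x"
  shows "\<exists>E::int. E \<noteq> 0 \<and> (\<forall>n. of_int E * x ^ n \<in> quadratic_order D)"
proof -
  obtain c :: int where c: "c \<noteq> 0" "of_int c * x \<in> quadratic_order D"
    using quadratic_field_denominator[OF assms(1)] by blast
  obtain f where f: "Polynomial.lead_coeff f = 1" "\<forall>i. Polynomial.coeff f i \<in> \<int>" "poly f x = 0"
    using assms(2) by (auto simp: algebraic_int.simps)
  define k where "k = Polynomial.degree f"
  have rec: "x ^ k = - (\<Sum>i<k. Polynomial.coeff f i * x ^ i)"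
  proof -
    have "(\<Sum>i<Suc k. Polynomial.coeff f i * x ^ i) = 0"
      using f(3) by (simp only: poly_altdef k_def lessThan_Suc_atMost)
    then show ?thesis using f(1) by (simp add: k_def eq_neg_iff_add_eq_0 add.commute)
  qed
  have "of_int (c ^ k) * x ^ n \<in> quadratic_order D" for n
  proof (induction n rule: less_induct)
    case (less n)
    show ?case
    proof (cases "n < k")
      case True
      then have "of_int (c ^ k) * x ^ n = of_int (c ^ (k - n)) * (of_int c * x) ^ n"
        by (simp add: power_mult_distrib power_add[symmetric] flip: mult.assoc)
      then show ?thesis
        using c by (auto intro!: quadratic_order_mult quadratic_order_power quadratic_order_of_int
            simp del: of_int_power)
    next
      case False
      then have "x ^ n = x ^ (n - k) * x ^ k" by (simp add: power_add[symmetric])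
      then have "of_int (c ^ k) * x ^ n =
          (\<Sum>i<k. - Polynomial.coeff f i * (of_int (c ^ k) * x ^ (n - k + i)))"
        by (simp add: rec power_add sum_distrib_left sum_negf algebra_simps)
      also have "\<dots> \<in> quadratic_order D"
      proof (rule quadratic_order_sum)
        fix i assume "i \<in> {..<k}"
        then have "of_int (c ^ k) * x ^ (n - k + i) \<in> quadratic_order D"
          using False by (intro less) auto
        moreover have "- Polynomial.coeff f i \<in> \<int>" using f(2) by simp
        then have "- Polynomial.coeff f i \<in> quadratic_order D"
          by (metis Ints_cases quadratic_order_of_int)
        ultimately show "- Polynomial.coeff f i * (of_int (c ^ k) * x ^ (n - k + i)) \<in> quadratic_order D"
          by (rule quadratic_order_mult[rotated])
      qed
      finally show ?thesis .
    qed
  qed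
  then show ?thesis using c(1) by (intro exI[of _ "c ^ k"]) auto
qed

text \<open>By multiplicativity of the modulus, \<open>(cmod e)\<^sup>2\<close> is a common
  denominator for all powers of the rational number \<open>(cmod x)\<^sup>2\<close>.\<close>

lemma norm_int_if_bounded_denominator_powers:
  assumes "D < 0" "x \<in> quadratic_field D" "e \<noteq> 0"
    and "\<And>n. (cmod (e * x ^ n))\<^sup>2 \<in> \<int>"
  shows "(cmod x)\<^sup>2 \<in> \<int>"
proof (rule rational_bounded_denominator_powers_int)
  show "(cmod x)\<^sup>2 \<in> \<rat>" using quadratic_field_norm[OF assms(1,2)] by auto
  show "(cmod e)\<^sup>2 \<noteq> 0" using assms(3) by simp
  show "(cmod e)\<^sup>2 * ((cmod x)\<^sup>2) ^ n \<in> \<int>" for n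
    using assms(4)[of n]
    by (simp add: norm_mult norm_power power_mult_distrib mult.commute flip: power_mult)
qed

lemma ring_of_integers_norm:
  assumes "D < 0" "x \<in> ring_of_integers (quadratic_field D)"
  shows "(cmod x)\<^sup>2 \<in> \<int>"
proof -
  have x: "x \<in> quadratic_field D" "algebraic_int x"
    using assms(2) by (auto simp: ring_of_integers_def)
  obtain E :: int where "E \<noteq> 0" "\<And>n. of_int E * x ^ n \<in> quadratic_order D"
    using algebraic_int_bounded_denominator_powers[OF x] by blast
  then show ?thesis
    using assms(1) x(1)
    by (intro norm_int_if_bounded_denominator_powers[of D x "of_int E"] quadratic_order_norm) auto
qed

section \<open>Fractional ideals and their multipliers\<close>

lemma fractional_idealD:
  assumes "fractional_ideal K I"
  shows "I \<subseteq> K" "0 \<in> I" "\<exists>y\<in>I. y \<noteq> 0"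
    "\<And>x y. x \<in> I \<Longrightarrow> y \<in> I \<Longrightarrow> x + y \<in> I" "\<And>x. x \<in> I \<Longrightarrow> - x \<in> I"
    "\<And>r x. r \<in> ring_of_integers K \<Longrightarrow> x \<in> I \<Longrightarrow> r * x \<in> I"
    "\<exists>d\<in>ring_of_integers K. d \<noteq> 0 \<and> (\<forall>x\<in>I. d * x \<in> ring_of_integers K)"
  using assms unfolding fractional_ideal_def subgroup_add_complex_field_iff by auto

text \<open>For a nonzero \<open>y\<close> in \<open>I\<close> and a denominator \<open>d\<close> of
  \<open>I\<close>, all \<open>d * y * x ^ n\<close> are algebraic integers. This takes the place of
  the determinant argument for a finitely generated module.\<close>

lemma fractional_ideal_multiplier_norm:
  assumes "D < 0" "fractional_ideal (quadratic_field D) I" "x \<in> quadratic_field D"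
    and stable: "\<And>y. y \<in> I \<Longrightarrow> x * y \<in> I"
  shows "(cmod x)\<^sup>2 \<in> \<int>"
proof -
  note I = fractional_idealD[OF assms(2)]
  obtain y where y: "y \<in> I" "y \<noteq> 0" using I(3) by blast
  obtain d where d: "d \<noteq> 0" "\<And>x. x \<in> I \<Longrightarrow> d * x \<in> ring_of_integers (quadratic_field D)"
    using I(7) by blast
  have pow: "x ^ n * y \<in> I" for n
    by (induction n) (auto simp: y mult.assoc intro: stable)
  have "(cmod (d * y * x ^ n))\<^sup>2 \<in> \<int>" for n
    using ring_of_integers_norm[OF assms(1) d(2)[OF pow[of n]]] by (simp add: mult_ac)
  then show ?thesis
    using assms(1,3) d(1) y(2) by (intro norm_int_if_bounded_denominator_powers[of D x "d * y"]) auto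
qed

text \<open>Since \<open>x + 1\<close> is a multiplier too, the trace \<open>2 * Re x\<close> is an
  integer. An odd trace is excluded modulo 4, because \<open>D mod 4 = 3\<close>.\<close>

lemma fractional_ideal_multiplier_Re:
  assumes "D < 0" "D mod 4 = 3" "fractional_ideal (quadratic_field D) I" "x \<in> quadratic_field D"
    and stable: "\<And>y. y \<in> I \<Longrightarrow> x * y \<in> I"
  shows "Re x \<in> \<int>"
proof -
  have N: "(cmod x)\<^sup>2 \<in> \<int>" using assms by (intro fractional_ideal_multiplier_norm) auto
  have "x + 1 \<in> quadratic_field D"
    using assms(4) by (rule quadratic_field_add) (simp add: quadratic_field_rat)
  then have N1: "(cmod (x + 1))\<^sup>2 \<in> \<int>"
    using assms fractional_idealD(4)[OF assms(3)]
    by (intro fractional_ideal_multiplier_norm[of D I]) (auto simp: algebra_simps)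
  have "2 * Re x = (cmod (x + 1))\<^sup>2 - (cmod x)\<^sup>2 - 1"
    unfolding cmod_power2 by (simp add: power2_eq_square algebra_simps)
  then have "2 * Re x \<in> \<int>" using N N1 by simp
  then obtain t :: int where t: "2 * Re x = of_int t" by (auto elim: Ints_cases)
  obtain n :: int where n: "(cmod x)\<^sup>2 = of_int n" using N by (auto elim: Ints_cases)
  obtain p q where pq: "p \<in> \<rat>" "q \<in> \<rat>" "Re x = p" "(cmod x)\<^sup>2 = p\<^sup>2 - q\<^sup>2 * of_int D"
    using quadratic_field_norm[OF assms(1,4)] by blast
  have "2 * q \<in> \<rat>" using pq by simp
  then obtain u v where uv: "v > 0" "Rings.coprime u v" "2 * q = of_int u / of_int v"
    by (elim Rats_cases') auto
  have "(of_int t)\<^sup>2 - (2 * q)\<^sup>2 * of_int D = 4 * real_of_int n"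
    using n pq t by (simp add: power_mult_distrib flip: t)
  then have "real_of_int (v\<^sup>2 * t\<^sup>2 - u\<^sup>2 * D) = of_int (4 * n * v\<^sup>2)"
    using uv(1) unfolding uv(3) by (simp add: power_divide field_simps)
  then have eq: "v\<^sup>2 * t\<^sup>2 - u\<^sup>2 * D = 4 * n * v\<^sup>2" by (simp only: of_int_eq_iff)
  obtain e where e: "D = 4 * e + 3" using assms(2) by (metis mult_div_mod_eq)
  have "even t"
  proof (rule ccontr)
    assume "odd t"
    then obtain t' where t': "t = 2 * t' + 1" by (elim oddE)
    have sq: "z\<^sup>2 mod 4 = (if even z then 0 else 1)" for z :: int
    proof (cases "even z")
      case True
      then obtain z' where "z = 2 * z'" by (elim evenE)
      then show ?thesis by (simp add: power_mult_distrib)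
    next
      case False
      then obtain z' where "z = 2 * z' + 1" by (elim oddE)
      then have "z\<^sup>2 = 4 * (z'\<^sup>2 + z') + 1" by (simp add: power2_eq_square algebra_simps)
      then show ?thesis using False by presburger
    qed
    \<comment> \<open>Modulo 4 the square of \<open>t\<close> is 1 and \<open>- D\<close> is 1, so
      the norm equation becomes a sum of two squares divisible by 4. Both are then even, against
      coprimality.\<close>
    have "v\<^sup>2 + u\<^sup>2 = 4 * (n * v\<^sup>2 - v\<^sup>2 * (t'\<^sup>2 + t') + u\<^sup>2 * (e + 1))"
      using eq unfolding e t' by Groebner_Basis.algebra
    then have "4 dvd v\<^sup>2 + u\<^sup>2" by simp
    then have "even u \<and> even v" using sq[of u] sq[of v] by (auto split: if_splits) presburger+
    then show False using uv(2) by (meson coprime_def odd_one)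
  qed
  then obtain t' where "t = 2 * t'" by (elim evenE)
  then have "Re x = of_int t'" using t by simp
  then show ?thesis by simp
qed

section \<open>Multiplication by an ideal with two generators\<close>

text \<open>For a fractional ideal \<open>I\<close> and integral \<open>a\<close>, \<open>b\<close>
  this is the product of the ideal (a, b) with \<open>I\<close>, written without finite sums of
  arbitrary length.\<close>

definition two_generator_mult :: "complex \<Rightarrow> complex \<Rightarrow> complex set \<Rightarrow> complex set" where
  "two_generator_mult a b I = {a * x + b * y | x y. x \<in> I \<and> y \<in> I}"

lemma two_generator_multI:
  "x \<in> I \<Longrightarrow> y \<in> I \<Longrightarrow> a * x + b * y \<in> two_generator_mult a b I"
  unfolding two_generator_mult_def by blast

lemma two_generator_multE:
  assumes "z \<in> two_generator_mult a b I"
  obtains x y where "x \<in> I" "y \<in> I" "z = a * x + b * y"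
  using assms unfolding two_generator_mult_def by blast

text \<open>This commutation lets the map descend to ideal classes.\<close>

lemma two_generator_mult_scale:
  "two_generator_mult a b ((*) c ` I) = (*) c ` two_generator_mult a b I"
proof -
  have "a * (c * x) + b * (c * y) = c * (a * x + b * y)" for x y
    by (simp add: algebra_simps)
  then show ?thesis unfolding two_generator_mult_def image_def
    by (auto; metis)
qed

lemma two_generator_mult_subset:
  assumes "fractional_ideal K I" "a \<in> ring_of_integers K" "b \<in> ring_of_integers K"
  shows "two_generator_mult a b I \<subseteq> I"
  using fractional_idealD[OF assms(1)] assms(2,3) unfolding two_generator_mult_def by auto

lemma fractional_ideal_two_generator_mult:
  assumes "fractional_ideal K I" "a \<in> ring_of_integers K" "b \<in> ring_of_integers K" "a \<noteq> 0"
  shows "fractional_ideal K (two_generator_mult a b I)"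
proof -
  note I = fractional_idealD[OF assms(1)]
  note sub = two_generator_mult_subset[OF assms(1-3)]
  let ?J = "two_generator_mult a b I"
  obtain y where y: "y \<in> I" "y \<noteq> 0" using I(3) by blast
  have "a * y + b * 0 \<in> ?J" using y I(2) by (intro two_generator_multI)
  moreover have "a * y + b * 0 \<noteq> 0" using y(2) assms(4) by simp
  ultimately have "?J \<noteq> {0}" by (metis singletonD)
  moreover have "0 \<in> ?J" using two_generator_multI[OF I(2) I(2), of a b] by simp
  moreover have "s + t \<in> ?J" if st: "s \<in> ?J" "t \<in> ?J" for s t
  proof -
    obtain x y x' y' where "x \<in> I" "y \<in> I" "x' \<in> I" "y' \<in> I" "s = a * x + b * y" "t = a * x' + b * y'"
      using st unfolding two_generator_mult_def by blast
    then show ?thesis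
      using two_generator_multI[of "x + x'" I "y + y'" a b] I(4) by (simp add: algebra_simps)
  qed
  \<comment> \<open>Stating this for every multiplier \<open>r\<close> of \<open>I\<close> covers
    both the ring of integers and, with \<open>r = -1\<close>, negation.\<close>
  moreover have "r * s \<in> ?J" if s: "s \<in> ?J" and r: "\<And>x. x \<in> I \<Longrightarrow> r * x \<in> I" for r s
  proof -
    obtain x y where "x \<in> I" "y \<in> I" "s = a * x + b * y"
      using s unfolding two_generator_mult_def by blast
    then show ?thesis
      using two_generator_multI[of "r * x" I "r * y" a b] r by (simp add: algebra_simps)
  qed
  moreover from this[of _ "-1"] have "- s \<in> ?J" if "s \<in> ?J" for s
    using that I(5) by simp
  moreover have "?J \<subseteq> K" using sub I(1) by (rule subset_trans)
  moreover have "\<exists>d\<in>ring_of_integers K. d \<noteq> 0 \<and> (\<forall>x\<in>?J. d * x \<in> ring_of_integers K)"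
    using sub I(7) by blast
  ultimately show ?thesis
    unfolding fractional_ideal_def subgroup_add_complex_field_iff
    using I(6) by simp
qed

text \<open>The cube of (a, b) is generated by a^3 = b b', a^2 b, a b^2 and b^3, hence equals b
  times (b', a^2, a b, b^2). The last ideal contains the comaximal elements \<open>b'\<close> and
  \<open>b ^ 2\<close>, so it acts trivially on \<open>I\<close>.\<close>

lemma two_generator_mult_cube:
  assumes "fractional_ideal K I" "a \<in> ring_of_integers K" "b \<in> ring_of_integers K"
    and "b' \<in> ring_of_integers K" "a ^ 3 = b * b'"
    and s: "\<And>x. x \<in> I \<Longrightarrow> s * x \<in> I" and t: "\<And>x. x \<in> I \<Longrightarrow> t * x \<in> I"
    and comaximal: "s * b' + t * b ^ 2 = 1"
  defines "T \<equiv> two_generator_mult a b"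
  shows "T (T (T I)) = (*) b ` I"
proof
  note I = fractional_idealD[OF assms(1)]
  show "T (T (T I)) \<subseteq> (*) b ` I"
  proof
    fix z assume "z \<in> T (T (T I))"
    then obtain y1 y2 where y: "y1 \<in> T (T I)" "y2 \<in> T (T I)" "z = a * y1 + b * y2"
      unfolding T_def by (rule two_generator_multE)
    obtain z1 z2 where z12: "z1 \<in> T I" "z2 \<in> T I" "y1 = a * z1 + b * z2"
      using y(1) unfolding T_def by (rule two_generator_multE)
    obtain z3 z4 where z34: "z3 \<in> T I" "z4 \<in> T I" "y2 = a * z3 + b * z4"
      using y(2) unfolding T_def by (rule two_generator_multE)
    obtain x1 x2 where x12: "x1 \<in> I" "x2 \<in> I" "z1 = a * x1 + b * x2"
      using z12(1) unfolding T_def by (rule two_generator_multE)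
    obtain x3 x4 where x34: "x3 \<in> I" "x4 \<in> I" "z2 = a * x3 + b * x4"
      using z12(2) unfolding T_def by (rule two_generator_multE)
    obtain x5 x6 where x56: "x5 \<in> I" "x6 \<in> I" "z3 = a * x5 + b * x6"
      using z34(1) unfolding T_def by (rule two_generator_multE)
    obtain x7 x8 where x78: "x7 \<in> I" "x8 \<in> I" "z4 = a * x7 + b * x8"
      using z34(2) unfolding T_def by (rule two_generator_multE)
    \<comment> \<open>The quotient of \<open>z\<close> by \<open>b\<close>, with
      \<open>a ^ 3\<close> replaced by \<open>b * b'\<close>.\<close>
    define y where "y = b' * x1 + a * (a * (x2 + x3 + x5)) + a * (b * (x4 + x6 + x7)) + b * (b * x8)"
    have "z = b * y" unfolding y(3) z12(3) z34(3) x12(3) x34(3) x56(3) x78(3) y_def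
      using assms(5) by Groebner_Basis.algebra
    moreover have "y \<in> I" unfolding y_def
      using x12(1,2) x34(1,2) x56(1,2) x78(1,2) by (intro I(4) I(6) assms(2-4))
    ultimately show "z \<in> (*) b ` I" by blast
  qed
  show "(*) b ` I \<subseteq> T (T (T I))"
  proof
    fix z assume "z \<in> (*) b ` I"
    then obtain x where x: "x \<in> I" "z = b * x" by blast
    \<comment> \<open>Comaximality multiplied by \<open>b * x\<close> reads
      \<open>b * x = a ^ 3 * (s * x) + b ^ 3 * (t * x)\<close>; only the two extreme terms of the
      expanded cube occur.\<close>
    have "z = a * (a * (a * (s * x) + b * 0) + b * (a * 0 + b * 0)) +
        b * (a * (a * 0 + b * 0) + b * (a * 0 + b * (t * x)))"
      unfolding x(2) using assms(5) comaximal by Groebner_Basis.algebra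
    also have "\<dots> \<in> T (T (T I))"
      unfolding T_def by (intro two_generator_multI s t x(1) I(2))
    finally show "z \<in> T (T (T I))" .
  qed
qed

section \<open>Ideal classes as sets of scaled ideals\<close>

lemma ideal_prod_principal:
  assumes "fractional_ideal K I" "1 \<in> K"
  shows "ideal_prod complex_field ((*) a ` ring_of_integers K) I = (*) a ` I"
proof
  note I = fractional_idealD[OF assms(1)]
  show "ideal_prod complex_field ((*) a ` ring_of_integers K) I \<subseteq> (*) a ` I"
  proof
    fix z assume "z \<in> ideal_prod complex_field ((*) a ` ring_of_integers K) I"
    then show "z \<in> (*) a ` I"
    proof induction
      case (prod i j)
      then show ?case using I(6) by (auto simp: complex_field_simps mult.assoc)
    next
      case (sum s1 s2)
      then show ?case using I(4) by (auto simp: complex_field_simps simp flip: distrib_left)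
    qed
  qed
  have "1 \<in> ring_of_integers K" using assms(2) by (simp add: ring_of_integers_def)
  then have "a * x \<in> ideal_prod complex_field ((*) a ` ring_of_integers K) I" if "x \<in> I" for x
    using ideal_prod.prod[of "a * 1" "(*) a ` ring_of_integers K" x I complex_field, OF imageI] that
    by (simp add: complex_field_simps)
  then show "(*) a ` I \<subseteq> ideal_prod complex_field ((*) a ` ring_of_integers K) I" by blast
qed

definition ideal_class :: "complex set \<Rightarrow> complex set \<Rightarrow> complex set set" where
  "ideal_class K I = {(*) a ` I | a. a \<in> K \<and> a \<noteq> 0}"

text \<open>The carrier of the quotient is the set of right cosets, and multiplying by a principal
  ideal is scaling. The class number thus becomes a count of plain sets.\<close>

lemma class_number_eq_card_ideal_classes:
  assumes "1 \<in> K"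
  shows "class_number K = card (ideal_class K ` {I. fractional_ideal K I})"
proof -
  have "principal_fractional_ideals K #>\<^bsub>ideal_group K\<^esub> I = ideal_class K I"
    if "fractional_ideal K I" for I
  proof -
    have "principal_fractional_ideals K #>\<^bsub>ideal_group K\<^esub> I =
        {ideal_prod complex_field ((*) a ` ring_of_integers K) I | a. a \<in> K \<and> a \<noteq> 0}"
      unfolding r_coset_def principal_fractional_ideals_def ideal_group_def by auto
    then show ?thesis
      using that assms by (simp add: ideal_class_def ideal_prod_principal)
  qed
  then have "rcosets\<^bsub>ideal_group K\<^esub> (principal_fractional_ideals K)
      = ideal_class K ` {I. fractional_ideal K I}"
    unfolding RCOSETS_def by (auto simp: ideal_group_def)
  then show ?thesis
    by (simp add: class_number_def class_group_def Coset.order_def FactGroup_def)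
qed

lemma two_generator_mult_ideal_class:
  "two_generator_mult a b ` ideal_class K I = ideal_class K (two_generator_mult a b I)"
proof -
  have "two_generator_mult a b ` ideal_class K I =
      {two_generator_mult a b ((*) c ` I) | c. c \<in> K \<and> c \<noteq> 0}"
    unfolding ideal_class_def by blast
  then show ?thesis unfolding ideal_class_def two_generator_mult_scale .
qed

text \<open>Multiplication by \<open>b\<close> permutes the nonzero elements of the field. Hence a
  map whose cube is scaling by \<open>b\<close> has trivial cube on classes.\<close>

lemma ideal_class_scale:
  assumes "b \<in> quadratic_field D" "b \<noteq> 0"
  shows "ideal_class (quadratic_field D) ((*) b ` I) = ideal_class (quadratic_field D) I"
proof
  show "ideal_class (quadratic_field D) ((*) b ` I) \<subseteq> ideal_class (quadratic_field D) I"
  proof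
    fix J assume "J \<in> ideal_class (quadratic_field D) ((*) b ` I)"
    then obtain a where a: "a \<in> quadratic_field D" "a \<noteq> 0" "J = (*) a ` (*) b ` I"
      unfolding ideal_class_def by blast
    then have "J = (*) (a * b) ` I" by (simp add: image_image mult.assoc)
    moreover have "a * b \<in> quadratic_field D" "a * b \<noteq> 0"
      using a assms by (auto intro: quadratic_field_mult)
    ultimately show "J \<in> ideal_class (quadratic_field D) I" unfolding ideal_class_def by blast
  qed
  show "ideal_class (quadratic_field D) I \<subseteq> ideal_class (quadratic_field D) ((*) b ` I)"
  proof
    fix J assume "J \<in> ideal_class (quadratic_field D) I"
    then obtain a where a: "a \<in> quadratic_field D" "a \<noteq> 0" "J = (*) a ` I"
      unfolding ideal_class_def by blast
    then have "J = (*) (a / b) ` (*) b ` I" using assms by (simp add: image_image)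
    moreover have "a / b \<in> quadratic_field D" "a / b \<noteq> 0"
      using a assms by (auto intro: quadratic_field_divide)
    ultimately show "J \<in> ideal_class (quadratic_field D) ((*) b ` I)"
      unfolding ideal_class_def by blast
  qed
qed

section \<open>Units, cube roots and the absence of fixed classes\<close>

text \<open>The real part is -1, 0 or 1, so \<open>u\<close> is one of 1, -1, i, -i. Such a
  \<open>u\<close> is the cube of its inverse.\<close>

lemma fourth_power_eq_1_if_Re_int:
  assumes "cmod u = 1" "Re u \<in> \<int>"
  shows "u ^ 4 = 1"
proof -
  obtain k :: int where k: "Re u = of_int k" using assms(2) by (auto elim: Ints_cases)
  have sum: "(Re u)\<^sup>2 + (Im u)\<^sup>2 = 1" using assms(1) by (simp flip: cmod_power2)
  have "\<bar>of_int k\<bar> \<le> (1::real)" using abs_Re_le_cmod[of u] k assms(1) by simp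
  then have "\<bar>k\<bar> \<le> 1" by linarith
  then have "Re u = 0 \<or> Re u = 1 \<or> Re u = -1" unfolding k by auto
  then have "(Re u = 0 \<and> (Im u = 1 \<or> Im u = -1)) \<or> (Im u = 0 \<and> (Re u = 1 \<or> Re u = -1))"
    using sum by (auto simp: power2_eq_1_iff)
  then have "u = \<i> \<or> u = -\<i> \<or> u = 1 \<or> u = -1" by (auto simp: complex_eq_iff)
  then show ?thesis by auto
qed

text \<open>The triple-angle formula for the cosine, scaled by the modulus; it leaves an equation in
  real part and norm alone.\<close>

lemma Re_cube: "Re (z ^ 3) = 4 * Re z ^ 3 - 3 * Re z * (cmod z)\<^sup>2"
  unfolding cmod_power2 by (simp add: power2_eq_square power3_eq_cube algebra_simps)

text \<open>
  If \<open>T I = c I\<close> then \<open>c\<^sup>3 I = \<beta> I\<close>, so \<open>c\<^sup>3\<close> and \<open>\<beta>\<close> differ by a unit, which is a cube.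
  The cube root of \<open>\<beta>\<close> thus obtained has integral real part \<open>x\<close> and norm \<open>m\<^sup>2\<close>, and comparing
  real parts gives \<open>4 x\<^sup>3 - 3 x m\<^sup>2 = 1 - m\<^sup>3\<close>, that is, \<open>(x + m) (2 x - m)\<^sup>2 = 1\<close>.
\<close>
lemma no_fixed_ideal_class:
  fixes m D :: int and \<beta> c :: complex
  defines "K \<equiv> quadratic_field D"
  assumes D: "D < 0" "D mod 4 = 3" and m: "m > 1" and I: "fractional_ideal K I"
    and \<beta>: "\<beta> \<in> K" "Re \<beta> = 1 - m ^ 3" "(cmod \<beta>)\<^sup>2 = m ^ 6"
    and c: "c \<in> K" "c \<noteq> 0" "\<And>x. x \<in> I \<Longrightarrow> c * x \<in> I"
    and cube: "(*) (c ^ 3) ` I = (*) \<beta> ` I"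
  shows False
proof -
  have "\<beta> \<noteq> 0" using \<beta>(3) m by auto
  define u where "u = c ^ 3 / \<beta>"
  have c3: "c ^ 3 = u * \<beta>" using \<open>\<beta> \<noteq> 0\<close> by (simp add: u_def)
  have "u \<noteq> 0" using c \<open>\<beta> \<noteq> 0\<close> by (simp add: u_def)
  have "u \<in> K" unfolding u_def power3_eq_cube K_def
    using c(1) \<beta>(1) by (intro quadratic_field_divide quadratic_field_mult) (auto simp: K_def)
  then have "inverse u \<in> K" unfolding K_def by (rule quadratic_field_inverse)
  have u: "u * x \<in> I" if "x \<in> I" for x
  proof -
    have "c ^ 3 * x \<in> (*) \<beta> ` I" unfolding cube[symmetric] using that by (rule imageI)
    then obtain y where "y \<in> I" "c ^ 3 * x = \<beta> * y" by blast
    then have "u * x = y" using \<open>\<beta> \<noteq> 0\<close> by (simp add: u_def field_simps)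
    then show ?thesis using \<open>y \<in> I\<close> by simp
  qed
  have u': "inverse u * x \<in> I" if "x \<in> I" for x
  proof -
    have "\<beta> * x \<in> (*) (c ^ 3) ` I" unfolding cube using that by (rule imageI)
    then obtain y where "y \<in> I" "\<beta> * x = c ^ 3 * y" by blast
    then have "inverse u * x = y" using \<open>\<beta> \<noteq> 0\<close> c(2) by (simp add: u_def field_simps)
    then show ?thesis using \<open>y \<in> I\<close> by simp
  qed
  \<comment> \<open>Both \<open>u\<close> and its inverse preserve \<open>I\<close>, so their norms
    are nonnegative integers with product 1.\<close>
  have "(cmod u)\<^sup>2 \<in> \<int>" "(cmod (inverse u))\<^sup>2 \<in> \<int>"
    using fractional_ideal_multiplier_norm[OF D(1) I[unfolded K_def]]
      \<open>u \<in> K\<close> \<open>inverse u \<in> K\<close> u u' unfolding K_def by blast+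
  then obtain i j :: int where ij: "(cmod u)\<^sup>2 = of_int i" "(cmod (inverse u))\<^sup>2 = of_int j"
    by (auto elim!: Ints_cases)
  have "real_of_int (i * j) = (cmod (u * inverse u))\<^sup>2"
    by (simp only: of_int_mult ij[symmetric] norm_mult power_mult_distrib)
  also have "\<dots> = of_int 1" using \<open>u \<noteq> 0\<close> by simp
  finally have "i * j = 1" by (simp only: of_int_eq_iff)
  moreover have "i \<ge> 0" using ij(1) by (metis of_int_0_le_iff zero_le_power2)
  ultimately have "i = 1" by (auto simp: zmult_eq_1_iff)
  then have "(cmod u)\<^sup>2 = 1" using ij(1) by simp
  then have norm_u: "cmod u = 1" by (metis abs_norm_cancel power2_eq_1_iff abs_minus abs_one)
  have "Re u \<in> \<int>"
    using fractional_ideal_multiplier_Re[OF D I[unfolded K_def]] \<open>u \<in> K\<close> u unfolding K_def by blast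
  then have u4: "u ^ 4 = 1" using norm_u by (intro fourth_power_eq_1_if_Re_int)
  \<comment> \<open>The cube root of \<open>\<beta>\<close>: from \<open>c ^ 3 = u * \<beta>\<close>
    the cube of \<open>c * u\<close> is \<open>u ^ 4 * \<beta>\<close>, and
    \<open>u ^ 4 = 1\<close>.\<close>
  define g where "g = c * u"
  have "g \<in> K" using c(1) \<open>u \<in> K\<close> unfolding g_def K_def by (rule quadratic_field_mult)
  moreover have "g * x \<in> I" if "x \<in> I" for x using c(3) u that by (simp add: g_def mult.assoc)
  ultimately have "Re g \<in> \<int>"
    using fractional_ideal_multiplier_Re[OF D I[unfolded K_def]] unfolding K_def by blast
  then obtain x :: int where x: "Re g = of_int x" by (auto elim: Ints_cases)
  have "g ^ 3 = u ^ 4 * \<beta>" unfolding g_def using c3 by Groebner_Basis.algebra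
  then have g3: "g ^ 3 = \<beta>" using u4 by simp
  have "((cmod g)\<^sup>2) ^ 3 = (cmod (g ^ 3))\<^sup>2" by (simp add: norm_power flip: power_mult)
  also have "\<dots> = ((of_int m)\<^sup>2) ^ 3" by (simp add: g3 \<beta>(3) flip: power_mult)
  finally have norm_g: "(cmod g)\<^sup>2 = (of_int m)\<^sup>2"
    by (rule power_eq_imp_eq_base) auto
  have "real_of_int (1 - m ^ 3) = of_int (4 * x ^ 3 - 3 * x * m\<^sup>2)"
    using Re_cube[of g] by (simp add: g3 \<beta>(2) norm_g x)
  then have "1 - m ^ 3 = 4 * x ^ 3 - 3 * x * m\<^sup>2" by (simp only: of_int_eq_iff)
  then have prod: "(x + m) * (2 * x - m)\<^sup>2 = 1" by Groebner_Basis.algebra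
  then have "x + m = 1 \<or> x + m = -1" "(2 * x - m)\<^sup>2 = 1 \<or> (2 * x - m)\<^sup>2 = -1"
    using zmult_eq_1_iff by blast+
  moreover have "(2 * x - m)\<^sup>2 \<ge> 0" by simp
  ultimately have "(2 * x - m)\<^sup>2 = 1" "x + m = 1" using prod by auto
  \<comment> \<open>With \<open>x = 1 - m\<close> the left side is \<open>2 - 3 * m\<close>, which
    is 1 or -1 only for \<open>m = 1\<close>.\<close>
  then have "2 * x - m = 1 \<or> 2 * x - m = -1" by (simp add: power2_eq_1_iff)
  then show False using \<open>x + m = 1\<close> m by presburger
qed

section \<open>The order-three action for D = 1 - 2 m^3\<close>

theorem theorem3p2:
  fixes m :: int
  assumes "odd m" and "m > 1"
  shows "3 dvd class_number (quadratic_field (1 - 2 * m ^ 3))"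
proof -
  define D where "D = 1 - 2 * m ^ 3"
  define K where "K = quadratic_field D"
  define w where "w = csqrt (of_int D)"
  define \<beta> where "\<beta> = of_int (1 - m ^ 3) + w"
  define \<beta>' where "\<beta>' = of_int (1 - m ^ 3) - w"
  define a :: complex where "a = of_int (m\<^sup>2)"
  define T where "T = two_generator_mult a \<beta>"
  have "m ^ 3 > 1" using assms(2) by simp
  then have D0: "D < 0" by (simp add: D_def)
  have "odd (m ^ 3)" using assms(1) by simp
  then obtain n where "m ^ 3 = 2 * n + 1" by (elim oddE)
  then have D4: "D mod 4 = 3" unfolding D_def by presburger
  have w2: "w\<^sup>2 = of_int D" by (simp add: w_def)
  have Re_w: "Re w = 0" and Im_w: "(Im w)\<^sup>2 = - of_int D"
    using D0 by (simp_all add: w_def csqrt_negative_int)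
  have ratK: "x \<in> K" if "x \<in> \<rat>" for x using that by (simp add: K_def quadratic_field_rat)
  have wK: "w \<in> K" by (simp add: K_def w_def quadratic_field_csqrt)
  have \<beta>K: "\<beta> \<in> K" and \<beta>'K: "\<beta>' \<in> K"
    using wK ratK[of "of_int (1 - m ^ 3)"] quadratic_field_add[of "of_int (1 - m ^ 3)" D]
      quadratic_field_uminus[of w D]
    unfolding \<beta>_def \<beta>'_def K_def by (auto simp only: diff_conv_add_uminus Rats_of_int)
  have Re_\<beta>: "Re \<beta> = 1 - m ^ 3" by (simp add: \<beta>_def Re_w)
  have "(cmod \<beta>)\<^sup>2 = of_int ((1 - m ^ 3)\<^sup>2 - D)"
    unfolding cmod_power2 by (simp add: \<beta>_def Re_w Im_w)
  also have "(1 - m ^ 3)\<^sup>2 - D = m ^ 6" unfolding D_def by Groebner_Basis.algebra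
  finally have norm_\<beta>: "(cmod \<beta>)\<^sup>2 = m ^ 6" by simp
  have "\<beta> \<noteq> 0" using norm_\<beta> assms(2) by auto
  have trace: "\<beta> + \<beta>' = of_int (2 - 2 * m ^ 3)" by (simp add: \<beta>_def \<beta>'_def)
  have "\<beta> * \<beta>' = of_int ((1 - m ^ 3)\<^sup>2) - w\<^sup>2"
    by (simp add: \<beta>_def \<beta>'_def power2_eq_square algebra_simps)
  also have "\<dots> = of_int ((1 - m ^ 3)\<^sup>2 - D)" by (simp add: w2)
  also have "(1 - m ^ 3)\<^sup>2 - D = m ^ 6" unfolding D_def by Groebner_Basis.algebra
  finally have norm: "\<beta> * \<beta>' = of_int (m ^ 6)" .
  \<comment> \<open>The quadratic equation with the trace and norm of \<open>\<beta>\<close>. Once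
    the trace is folded to \<open>\<beta> + \<beta>'\<close>, the hypothesis for either root is the
    norm identity.\<close>
  have root: "algebraic_int x" if "x * (of_int (2 - 2 * m ^ 3) - x) = of_int (m ^ 6)" for x :: complex
  proof (rule algebraic_int.intros)
    let ?f = "[:of_int (m ^ 6), - of_int (2 - 2 * m ^ 3), 1:] :: complex poly"
    show "Polynomial.lead_coeff ?f = 1" by simp
    show "\<forall>i. Polynomial.coeff ?f i \<in> \<int>" by (auto simp: coeff_pCons split: nat.splits)
    show "poly ?f x = 0" unfolding that[symmetric] by (simp add: algebra_simps)
  qed
  have \<beta>O: "\<beta> \<in> ring_of_integers K"
    using \<beta>K norm root[of \<beta>, folded trace] by (simp add: ring_of_integers_def)
  have \<beta>'O: "\<beta>' \<in> ring_of_integers K"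
    using \<beta>'K norm root[of \<beta>', folded trace] by (simp add: ring_of_integers_def mult.commute)
  have intO: "of_int n \<in> ring_of_integers K" for n
    by (auto simp: ring_of_integers_def intro: ratK)
  have aO: "a \<in> ring_of_integers K" unfolding a_def by (rule intO)
  have "a \<noteq> 0" using assms(2) by (simp add: a_def)
  \<comment> \<open>Coprimality of trace and norm yields comaximality of \<open>\<beta>\<close> and
    \<open>\<beta>'\<close>. Oddness of \<open>m\<close> takes care of the factor 2.\<close>
  have "Rings.coprime (2 - 2 * m ^ 3) m"
  proof -
    have "Rings.coprime (1 - m * m\<^sup>2) m"
    proof (rule coprimeI)
      fix d assume d: "d dvd 1 - m * m\<^sup>2" "d dvd m"
      then have "d dvd (1 - m * m\<^sup>2) + m * m\<^sup>2" by (intro dvd_add dvd_mult2)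
      then show "is_unit d" by simp
    qed
    moreover have "Rings.coprime 2 m" using assms(1) by simp
    moreover have "2 - 2 * m ^ 3 = 2 * (1 - m * m\<^sup>2)" by Groebner_Basis.algebra
    ultimately show ?thesis by (simp only: coprime_mult_left_iff)
  qed
  then have "Rings.coprime ((2 - 2 * m ^ 3)\<^sup>2) (m ^ 6)" by simp
  then obtain k l where kl: "k * (2 - 2 * m ^ 3)\<^sup>2 + l * m ^ 6 = 1"
    by (metis bezout_int coprime_imp_gcd_eq_1)
  \<comment> \<open>With t the trace, t^2 = \<beta>^2 + (2 t - \<beta>') \<beta>'. Inserting this
    into k t^2 + l \<beta> \<beta>' = 1 and collecting the multiples of \<open>\<beta>'\<close>
    gives \<open>s\<close>.\<close>
  define s where "s = of_int k * (of_int (2 * (2 - 2 * m ^ 3)) - \<beta>') + of_int l * \<beta>"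
  have comax: "s * \<beta>' + of_int k * \<beta>\<^sup>2 = 1"
  proof -
    have "s * \<beta>' + of_int k * \<beta>\<^sup>2 = of_int k * (\<beta> + \<beta>')\<^sup>2 + of_int l * (\<beta> * \<beta>')"
      unfolding s_def of_int_mult trace[symmetric] by (simp add: power2_eq_square algebra_simps)
    also have "\<dots> = of_int (k * (2 - 2 * m ^ 3)\<^sup>2 + l * m ^ 6)"
      unfolding trace norm by simp
    finally show ?thesis by (simp add: kl)
  qed
  have T_cube: "T (T (T I)) = (*) \<beta> ` I" if I: "fractional_ideal K I" for I
    unfolding T_def
  proof (rule two_generator_mult_cube[OF I aO \<beta>O \<beta>'O _ _ _ comax])
    note cl = fractional_idealD[OF I]
    show "a ^ 3 = \<beta> * \<beta>'" by (simp add: norm a_def flip: power_mult)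
    show "of_int k * x \<in> I" if "x \<in> I" for x using that cl(6) intO by blast
    show "s * x \<in> I" if "x \<in> I" for x
    proof -
      \<comment> \<open>The expansion uses closure of \<open>I\<close> under addition, negation and
        known integral factors, rather than integrality of \<open>s\<close>.\<close>
      have "s * x = of_int k * (of_int (2 * (2 - 2 * m ^ 3)) * x + - (\<beta>' * x)) + of_int l * (\<beta> * x)"
        by (simp add: s_def algebra_simps)
      then show ?thesis using that intO \<beta>O \<beta>'O by (auto simp only: intro!: cl(4-6))
    qed
  qed
  have T_frac: "fractional_ideal K (T I)" if "fractional_ideal K I" for I
    unfolding T_def using that aO \<beta>O \<open>a \<noteq> 0\<close> by (rule fractional_ideal_two_generator_mult)
  let ?Cl = "ideal_class K ` {I. fractional_ideal K I}"
  have image_class: "(`) T (ideal_class K I) = ideal_class K (T I)" for I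
    unfolding T_def by (rule two_generator_mult_ideal_class)
  have "3 dvd card ?Cl"
  proof (rule three_dvd_card_free_cyclic_map[of ?Cl "(`) T"])
    fix C assume "C \<in> ?Cl"
    then obtain I where C: "C = ideal_class K I" and I: "fractional_ideal K I" by blast
    show "T ` C \<in> ?Cl" unfolding C image_class using T_frac[OF I] by blast
    show "T ` T ` T ` C = C"
      unfolding C image_class T_cube[OF I] unfolding K_def
      using \<beta>K \<open>\<beta> \<noteq> 0\<close> by (intro ideal_class_scale) (auto simp: K_def)
    show "T ` C \<noteq> C"
    proof
      assume "T ` C = C"
      moreover have "T I \<in> ideal_class K (T I)"
        unfolding ideal_class_def by (auto intro!: exI[of _ 1] ratK)
      ultimately have "T I \<in> ideal_class K I" by (simp add: C image_class)
      then obtain c where c: "c \<in> K" "c \<noteq> 0" "T I = (*) c ` I"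
        unfolding ideal_class_def by blast
      have T_scale: "T ((*) c ` J) = (*) c ` T J" for J
        unfolding T_def by (rule two_generator_mult_scale)
      have "(*) (c ^ 3) ` I = T (T (T I))"
        unfolding c(3) T_scale by (simp add: image_image power3_eq_cube mult.assoc)
      then have "(*) (c ^ 3) ` I = (*) \<beta> ` I" by (simp add: T_cube[OF I])
      \<comment> \<open>Since \<open>a\<close> and \<open>\<beta>\<close> are integral,
        \<open>T I\<close> lies in \<open>I\<close>, so \<open>c\<close> is a multiplier of
        \<open>I\<close>.\<close>
      moreover have "c * x \<in> I" if "x \<in> I" for x
        using two_generator_mult_subset[OF I aO \<beta>O] c(3) that unfolding T_def by blast
      ultimately show False
        using no_fixed_ideal_class[OF D0 D4 assms(2) I[unfolded K_def] \<beta>K[unfolded K_def] Re_\<beta> norm_\<beta>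
            c(1)[unfolded K_def] c(2)] by blast
    qed
  qed
  then show ?thesis
    using class_number_eq_card_ideal_classes[of K] ratK[of 1] by (simp add: K_def D_def)
qed

end
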